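(* Let $W\subseteq\mathbb{R}^n$ be closed and convex, let $f(w,z)$ be an $L$-smooth convex loss function in $w\in W$ for each $z\in\mathcal{Z}$, and assume that the stochastic gradient $\nabla_w f(w,z)$ has $\sigma^2$-bounded variance for all $w\in W$. If the update rule $\phi$ has the serial regret bound $\psi(\sigma^2,m)$ (in the sense of the context), then the expected regret $\mathbb E[R(m)]$ of the serial mini-batch algorithm with batch size $b$ over $m$ inputs is at most $$b\,\psi\!\left(\frac{\sigma^2}{b},\left\lceil\frac mb\right\rceil\right).$$ If $\psi(\sigma^2,m)=2D^2L+2D\sigma\sqrt m$ (that is, $\psi(v,m)=2D^2L+2D\sqrt v\,\sqrt m$ for all $v\ge0$, with a constant $D\ge0$), then the expected regret is bounded by $$2bD^2L+2D\sigma\sqrt{m+b}.$$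
   Context: **Problem.** $z_1,z_2,\dots$ are i.i.d. samples from an unknown distribution on a sample space $\mathcal Z$. $\|\cdot\|$ is the Euclidean norm. $f:W\times\mathcal Z\to\mathbb R$ is the loss, $F(w)=\mathbb E_z[f(w,z)]$ (finite on $W$, with $\nabla F(w)=\mathbb E_z[\nabla_w f(w,z)]$), and $w^\star\in\arg\min_{w\in W}F(w)$ is assumed to exist. "$L$-smooth" means $\|\nabla_w f(w,z)-\nabla_w f(w',z)\|\le L\|w-w'\|$ for all $z\in\mathcal Z$ and $w,w'\in W$. "$v$-bounded variance" means $\mathbb E_z\|\nabla_w f(w,z)-\nabla F(w)\|^2\le v$ for all $w\in W$. **Update rule and serial algorithm.** An update rule is a deterministic map $\phi$ taking an auxiliary state $a_j$, a vector $g_j\in\mathbb R^n$ and a parameter $\alpha_j$, and returning $(w_{j+1},a_{j+1})=\phi(a_j,g_j,\alpha_j)$ with $w_{j+1}\in W$; the initial $w_1\in W$ and $a_1$ are fixed. The parameter sequence may be chosen depending on the variance bound $v$; write it $(\alpha_j^{(v)})$. The serial algorithm, for $j=1,2,\dots$: predicts $w_j$, receives $z_j$, suffers loss $f(w_j,z_j)$, sets $g_j=\nabla_w f(w_j,z_j)$ and $(w_{j+1},a_{j+1})=\phi(a_j,g_j,\alpha_j)$. **Serial regret bound.** $\psi(v,m)$ is a function, nondecreasing in both arguments. "$\phi$ has the serial regret bound $\psi$" means: for every $v\ge0$ and every loss $f':W\times\mathcal Z'\to\mathbb R$ with i.i.d. inputs $z'_1,z'_2,\dots$ on a sample space $\mathcal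 Z'$ such that $f'$ is convex and $L$-smooth in $w$, $\mathbb E_{z'}[f'(w,z')]=F(w)$ on $W$, and the gradients of $f'$ have $v$-bounded variance, the serial algorithm run on $f'$ with parameters $(\alpha^{(v)}_j)$ satisfies $\mathbb E\big[\sum_{j=1}^m (f'(w_j,z'_j)-f'(w^\star,z'_j))\big]\le\psi(v,m)$ for all $m\ge1$. **Serial mini-batch algorithm.** $b\ge1$ is an integer batch size. For $j=1,2,\dots$, on all inputs $z_{(j-1)b+1},\dots,z_{jb}$ of batch $j$ the algorithm predicts the same $w_j$ and suffers the losses $f(w_j,z_i)$; it forms $\bar g_j=\frac1b\sum_{s=1}^b\nabla_wf(w_j,z_{(j-1)b+s})$ and, at the end of the batch, sets $(w_{j+1},a_{j+1})=\phi(a_j,\bar g_j,\alpha_j)$ with $\alpha_j=\alpha_j^{(\sigma^2/b)}$. Its regret over $m$ inputs is $R(m)=\sum_{i=1}^m\big(f(w_{\lceil i/b\rceil},z_i)-f(w^\star,z_i)\big)$. *)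

theory Defs
  imports "HOL-Probability.Probability"
begin

text \<open>
  Losses are curried, \<open>f w z\<close>, and come with their gradient \<open>g w z\<close> in the first argument.
  The derivative is taken within \<open>W\<close>, because \<open>f\<close> is only given on \<open>W\<close>; if \<open>W\<close> has empty
  interior this does not determine the gradient, and \<open>g\<close> is one admissible choice.
\<close>

definition gradient_on ::
  "('w::real_inner) set \<Rightarrow> ('w \<Rightarrow> real) \<Rightarrow> ('w \<Rightarrow> 'w) \<Rightarrow> bool" where
  "gradient_on W F G \<longleftrightarrow> (\<forall>w\<in>W. (F has_derivative (\<lambda>h. G w \<bullet> h)) (at w within W))"

definition convex_smooth_loss ::
  "('w::real_inner) set \<Rightarrow> real \<Rightarrow> 'z set \<Rightarrow> ('w \<Rightarrow> 'z \<Rightarrow> real) \<Rightarrow> ('w \<Rightarrow> 'z \<Rightarrow> 'w) \<Rightarrow> bool" where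
  "convex_smooth_loss W L \<Z> f g \<longleftrightarrow>
     (\<forall>z\<in>\<Z>. convex_on W (\<lambda>w. f w z) \<and>
            gradient_on W (\<lambda>w. f w z) (\<lambda>w. g w z) \<and>
            (\<forall>w\<in>W. \<forall>w'\<in>W. norm (g w z - g w' z) \<le> L * norm (w - w')))"

definition has_expected_loss ::
  "('w::euclidean_space) set \<Rightarrow> 'z measure \<Rightarrow> ('w \<Rightarrow> 'z \<Rightarrow> real) \<Rightarrow> ('w \<Rightarrow> 'z \<Rightarrow> 'w) \<Rightarrow>
   ('w \<Rightarrow> real) \<Rightarrow> ('w \<Rightarrow> 'w) \<Rightarrow> bool" where
  "has_expected_loss W P f g F gradF \<longleftrightarrow>
     gradient_on W F gradF \<and>
     (\<forall>w\<in>W. has_bochner_integral P (f w) (F w) \<and> has_bochner_integral P (g w) (gradF w))"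

definition bounded_variance ::
  "('w::euclidean_space) set \<Rightarrow> 'z measure \<Rightarrow> ('w \<Rightarrow> 'z \<Rightarrow> 'w) \<Rightarrow> ('w \<Rightarrow> 'w) \<Rightarrow> real \<Rightarrow> bool" where
  "bounded_variance W P g gradF v \<longleftrightarrow>
     (\<forall>w\<in>W. integrable P (\<lambda>z. (norm (g w z - gradF w))\<^sup>2) \<and>
            (\<integral>z. (norm (g w z - gradF w))\<^sup>2 \<partial>P) \<le> v)"

text \<open>
  An update rule maps an auxiliary state, a vector and a parameter to the next prediction
  and auxiliary state. The measure \<open>A\<close> only supplies the space of auxiliary states and its
  sigma-algebra; measurability makes the predictions random variables.
\<close>

definition update_rule ::
  "('w::euclidean_space) set \<Rightarrow> 'a measure \<Rightarrow> ('a \<Rightarrow> 'w \<Rightarrow> 'p \<Rightarrow> 'w \<times> 'a) \<Rightarrow> bool" where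
  "update_rule W A \<phi> \<longleftrightarrow>
     (\<forall>p. (\<lambda>(a, g). \<phi> a g p) \<in> A \<Otimes>\<^sub>M borel \<rightarrow>\<^sub>M borel \<Otimes>\<^sub>M A) \<and>
     (\<forall>a\<in>space A. \<forall>g p. fst (\<phi> a g p) \<in> W)"

text \<open>
  Samples, steps and parameters are numbered from 1. If \<open>G j w\<close> is the vector used in step
  \<open>j\<close> at prediction \<open>w\<close>, then \<open>state \<phi> \<alpha> (w\<^sub>1, a\<^sub>1) G k\<close> is \<open>(w\<^sub>k\<^sub>+\<^sub>1, a\<^sub>k\<^sub>+\<^sub>1)\<close>.
\<close>

primrec state ::
  "('a \<Rightarrow> 'w \<Rightarrow> 'p \<Rightarrow> 'w \<times> 'a) \<Rightarrow> (nat \<Rightarrow> 'p) \<Rightarrow> 'w \<times> 'a \<Rightarrow> (nat \<Rightarrow> 'w \<Rightarrow> 'w) \<Rightarrow> nat \<Rightarrow> 'w \<times> 'a"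
where
  "state \<phi> \<alpha> s G 0 = s"
| "state \<phi> \<alpha> s G (Suc k) =
     (case state \<phi> \<alpha> s G k of (w, a) \<Rightarrow> \<phi> a (G (Suc k) w) (\<alpha> (Suc k)))"

definition prediction ::
  "('a \<Rightarrow> 'w \<Rightarrow> 'p \<Rightarrow> 'w \<times> 'a) \<Rightarrow> (nat \<Rightarrow> 'p) \<Rightarrow> 'w \<times> 'a \<Rightarrow> (nat \<Rightarrow> 'w \<Rightarrow> 'w) \<Rightarrow> nat \<Rightarrow> 'w" where
  "prediction \<phi> \<alpha> s G j = fst (state \<phi> \<alpha> s G (j - 1))"

definition serial_gradient :: "('w \<Rightarrow> 'z \<Rightarrow> 'w) \<Rightarrow> (nat \<Rightarrow> 'z) \<Rightarrow> nat \<Rightarrow> 'w \<Rightarrow> 'w" where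
  "serial_gradient g z j w = g w (z j)"

definition serial_regret ::
  "('a \<Rightarrow> 'w \<Rightarrow> 'p \<Rightarrow> 'w \<times> 'a) \<Rightarrow> (nat \<Rightarrow> 'p) \<Rightarrow> 'w \<times> 'a \<Rightarrow> ('w \<Rightarrow> 'z \<Rightarrow> real) \<Rightarrow> ('w \<Rightarrow> 'z \<Rightarrow> 'w) \<Rightarrow>
   'w \<Rightarrow> (nat \<Rightarrow> 'z) \<Rightarrow> nat \<Rightarrow> real" where
  "serial_regret \<phi> \<alpha> s f g wstar z m =
     (\<Sum>j=1..m. f (prediction \<phi> \<alpha> s (serial_gradient g z) j) (z j) - f wstar (z j))"

definition minibatch_gradient ::
  "nat \<Rightarrow> ('w::real_vector \<Rightarrow> 'z \<Rightarrow> 'w) \<Rightarrow> (nat \<Rightarrow> 'z) \<Rightarrow> nat \<Rightarrow> 'w \<Rightarrow> 'w" where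
  "minibatch_gradient b g z j w = (1 / real b) *\<^sub>R (\<Sum>s=1..b. g w (z ((j - 1) * b + s)))"

definition minibatch_regret ::
  "nat \<Rightarrow> ('a \<Rightarrow> 'w \<Rightarrow> 'p \<Rightarrow> 'w \<times> 'a) \<Rightarrow> (nat \<Rightarrow> 'p) \<Rightarrow> 'w \<times> 'a \<Rightarrow> ('w::real_vector \<Rightarrow> 'z \<Rightarrow> real) \<Rightarrow>
   ('w \<Rightarrow> 'z \<Rightarrow> 'w) \<Rightarrow> 'w \<Rightarrow> (nat \<Rightarrow> 'z) \<Rightarrow> nat \<Rightarrow> real" where
  "minibatch_regret b \<phi> \<alpha> s f g wstar z m =
     (\<Sum>i=1..m. f (prediction \<phi> \<alpha> s (minibatch_gradient b g z) (nat \<lceil>real i / real b\<rceil>)) (z i)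
                - f wstar (z i))"

definition iid_samples :: "'o measure \<Rightarrow> 'z measure \<Rightarrow> (nat \<Rightarrow> 'o \<Rightarrow> 'z) \<Rightarrow> bool" where
  "iid_samples M P Z \<longleftrightarrow>
     prob_space.indep_vars M (\<lambda>_. P) Z {1..} \<and> (\<forall>i\<ge>1. distr M P (Z i) = P)"

text \<open>
  The regret bound quantifies over all distributions \<open>P'\<close> and losses \<open>f'\<close> with the given
  expected loss. The i.i.d. inputs are the coordinates of the infinite product of \<open>P'\<close>;
  the law of the regret depends on nothing else. As HOL cannot quantify over types inside
  a formula, the type of the samples is a parameter. Integrability is required explicitly
  because the Bochner integral of a non-integrable function is 0.
\<close>

definition serial_regret_bound ::
  "'s itself \<Rightarrow> ('w::euclidean_space) set \<Rightarrow> real \<Rightarrow> ('w \<Rightarrow> real) \<Rightarrow> ('w \<Rightarrow> 'w) \<Rightarrow> 'w \<Rightarrow>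
   ('a \<Rightarrow> 'w \<Rightarrow> 'p \<Rightarrow> 'w \<times> 'a) \<Rightarrow> (real \<Rightarrow> nat \<Rightarrow> 'p) \<Rightarrow> 'w \<times> 'a \<Rightarrow> (real \<Rightarrow> nat \<Rightarrow> real) \<Rightarrow> bool" where
  "serial_regret_bound _ W L F gradF wstar \<phi> \<alpha> s \<psi> \<longleftrightarrow>
     (\<forall>v\<ge>0. \<forall>(P' :: 's measure) f' g'.
        prob_space P' \<longrightarrow>
        convex_smooth_loss W L (space P') f' g' \<longrightarrow>
        has_expected_loss W P' f' g' F gradF \<longrightarrow>
        bounded_variance W P' g' gradF v \<longrightarrow>
        (\<forall>m\<ge>1.
           integrable (\<Pi>\<^sub>M i\<in>{1..}. P') (\<lambda>z. serial_regret \<phi> (\<alpha> v) s f' g' wstar z m) \<and>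
           (\<integral>z. serial_regret \<phi> (\<alpha> v) s f' g' wstar z m \<partial>(\<Pi>\<^sub>M i\<in>{1..}. P')) \<le> \<psi> v m))"

end

theory Submission
  imports Defs
begin

text \<open>
  Group the samples into blocks of length \<open>b\<close>. The blocks are i.i.d., and on them the mini-batch
  algorithm is the serial algorithm for the averaged loss, whose gradients have variance at
  most \<open>\<sigma>\<^sup>2 / b\<close>. As a prediction is independent of its block, each sample of block \<open>j\<close> contributes
  the same expected regret \<open>\<nu> j \<ge> 0\<close>; completing the last block therefore only increases the
  expected regret, and over \<open>k\<close> full blocks it is \<open>b\<close> times the serial regret.
  The serial bound only makes the regret of a whole block integrable; the single terms are
  integrable because, conditionally on the prediction, they are i.i.d.
\<close>

section \<open>Joint measurability of losses and gradients\<close>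

text \<open>Replace \<open>w\<close> by a point of a countable dense subset of \<open>W\<close>
  within distance \<open>1 / Suc n\<close>. The result is jointly measurable, being
  \<open>h (d i)\<close> on each of countably many measurable pieces, and by continuity it converges
  pointwise to \<open>h\<close>. This makes the loss at a random prediction a random
  variable.\<close>

lemma borel_measurable_caratheodory:
  fixes h :: "'w::{metric_space, second_countable_topology} \<Rightarrow> 'z \<Rightarrow> 'v::metric_space"
  assumes meas: "\<And>w. w \<in> W \<Longrightarrow> h w \<in> borel_measurable P"
    and cont: "\<And>z. z \<in> space P \<Longrightarrow> continuous_on W (\<lambda>w. h w z)"
  shows "(\<lambda>(w, z). h w z) \<in> borel_measurable (restrict_space borel W \<Otimes>\<^sub>M P)"
proof (cases "W = {}")
  case True
  then show ?thesis
    by (intro measurableI) (auto simp: space_pair_measure space_restrict_space space_empty_iff)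
next
  case False
  obtain D where D: "countable D" "D \<subseteq> W" "W \<subseteq> closure D"
    by (rule separable)
  have "D \<noteq> {}"
    using False D by auto
  define d where "d = from_nat_into D"
  have dW: "d i \<in> W" for i
    using from_nat_into[OF \<open>D \<noteq> {}\<close>] D(2) by (auto simp: d_def)
  \<comment> \<open>Taking the least admissible index makes the choice of approximating point
    measurable in \<open>w\<close>.\<close>
  define near where "near n w = (LEAST i. dist w (d i) < 1 / Suc n)" for n and w :: 'w
  have near: "dist w (d (near n w)) < 1 / Suc n" if "w \<in> W" for n w
  proof -
    have "w \<in> closure D"
      using that D by auto
    then obtain y where "y \<in> D" "dist y w < 1 / Suc n"
      unfolding closure_approachable by (meson of_nat_0_less_iff zero_less_Suc zero_less_divide_1_iff)
    moreover obtain i where "y = d i"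
      using from_nat_into_surj[OF D(1) \<open>y \<in> D\<close>] by (auto simp: d_def)
    ultimately have "dist w (d i) < 1 / Suc n"
      by (simp add: dist_commute)
    then show ?thesis
      unfolding near_def by (rule LeastI)
  qed
  let ?N = "restrict_space borel W \<Otimes>\<^sub>M P"
  show ?thesis
  proof (rule borel_measurable_LIMSEQ_metric)
    fix n
    have id: "(\<lambda>w. w) \<in> restrict_space borel W \<rightarrow>\<^sub>M borel"
      by (rule measurable_restrict_space1) simp
    have "near n \<in> borel \<rightarrow>\<^sub>M count_space UNIV"
      unfolding near_def by measurable
    then have "(\<lambda>p. near n (fst p)) \<in> ?N \<rightarrow>\<^sub>M count_space UNIV"
      by (rule measurable_compose[OF measurable_compose[OF measurable_fst id]])
    moreover have "(\<lambda>p. h (d i) (snd p)) \<in> borel_measurable ?N" for i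
      by (rule measurable_compose[OF measurable_snd meas[OF dW]])
    ultimately show "(\<lambda>p. h (d (near n (fst p))) (snd p)) \<in> borel_measurable ?N"
      by (rule measurable_compose_countable[rotated])
  next
    fix p
    assume "p \<in> space ?N"
    then have p: "fst p \<in> W" "snd p \<in> space P"
      by (auto simp: space_pair_measure space_restrict_space)
    have "(\<lambda>n. dist (fst p) (d (near n (fst p)))) \<longlonglongrightarrow> 0"
      by (rule tendsto_sandwich[OF _ _ tendsto_const LIMSEQ_inverse_real_of_nat])
         (use near[OF p(1)] in \<open>auto intro!: always_eventually less_imp_le simp: inverse_eq_divide\<close>)
    then have "(\<lambda>n. d (near n (fst p))) \<longlonglongrightarrow> fst p"
      by (subst tendsto_dist_iff) (simp add: dist_commute)
    then show "(\<lambda>n. h (d (near n (fst p))) (snd p)) \<longlonglongrightarrow> (case p of (w, z) \<Rightarrow> h w z)"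
      using continuous_on_tendsto_compose[OF cont[OF p(2)], of "\<lambda>n. d (near n (fst p))" "fst p" sequentially]
      by (simp add: p dW case_prod_beta)
  qed
qed

section \<open>Coordinates of product measures\<close>

lemma has_bochner_integral_PiM_component:
  fixes u :: "'z \<Rightarrow> 'v::{banach, second_countable_topology}"
  assumes "prob_space P" "i \<in> I" and u: "has_bochner_integral P u c"
  shows "has_bochner_integral (PiM I (\<lambda>_. P)) (\<lambda>\<zeta>. u (\<zeta> i)) c"
proof -
  have *: "(\<lambda>\<zeta>. \<zeta> i) \<in> PiM I (\<lambda>_. P) \<rightarrow>\<^sub>M P" "u \<in> borel_measurable P"
    using assms by (auto intro: has_bochner_integral_integrable simp: has_bochner_integral_iff)
  have "has_bochner_integral (distr (PiM I (\<lambda>_. P)) P (\<lambda>\<zeta>. \<zeta> i)) u c"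
    using distr_PiM_component[of I "\<lambda>_. P" i] assms by simp
  then show ?thesis
    using * by (simp add: has_bochner_integral_iff integrable_distr_eq integral_distr)
qed

text \<open>The joint law of the coordinates is the product measure itself, and its factors are
  their marginals.\<close>

lemma indep_vars_PiM_components:
  assumes P: "\<And>i. i \<in> I \<Longrightarrow> prob_space (M i)" and "I \<noteq> {}"
  shows "prob_space.indep_vars (PiM I M) M (\<lambda>i \<zeta>. \<zeta> i) I"
proof -
  interpret Q: prob_space "PiM I M"
    by (rule prob_space_PiM) (rule P)
  have "distr (PiM I M) (PiM I M) (\<lambda>\<zeta>. \<lambda>i\<in>I. \<zeta> i) = distr (PiM I M) (PiM I M) (\<lambda>\<zeta>. \<zeta>)"
    by (rule distr_cong) (auto simp: space_PiM PiE_def extensional_restrict)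
  also have "\<dots> = (\<Pi>\<^sub>M i\<in>I. distr (PiM I M) (M i) (\<lambda>\<zeta>. \<zeta> i))"
    by (subst PiM_cong[OF refl distr_PiM_component[OF P]]) (auto simp: distr_id)
  finally show ?thesis
    by (subst Q.indep_vars_iff_distr_eq_PiM'[OF \<open>I \<noteq> {}\<close>]) auto
qed

lemma (in prob_space) indep_vars_imp_indep_var:
  assumes "indep_vars N X I" "i \<in> I" "j \<in> I" "i \<noteq> j"
  shows "indep_var (N i) (X i) (N j) (X j)"
proof -
  have "indep_var (PiM {i} N) (\<lambda>\<omega>. restrict (\<lambda>i. X i \<omega>) {i}) (PiM {j} N) (\<lambda>\<omega>. restrict (\<lambda>i. X i \<omega>) {j})"
    using assms by (intro indep_var_restrict) auto
  from indep_var_compose[OF this, of "\<lambda>x. x i" "N i" "\<lambda>x. x j" "N j"] show ?thesis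
    by (simp add: comp_def)
qed

text \<open>Expand the inner product over \<open>Basis\<close>. In each summand the two factors are
  independent, so integrability of the factors gives that of the product, and the expectation
  factors with one factor zero.\<close>

lemma has_bochner_integral_inner_components:
  fixes k u :: "'z \<Rightarrow> 'v::euclidean_space"
  assumes P: "prob_space P" and st: "s \<in> I" "t \<in> I" "s \<noteq> t"
    and k: "integrable P k" and u: "has_bochner_integral P u 0"
  shows "has_bochner_integral (PiM I (\<lambda>_. P)) (\<lambda>\<zeta>. k (\<zeta> s) \<bullet> u (\<zeta> t)) 0"
proof -
  let ?Q = "PiM I (\<lambda>_. P)"
  interpret Q: prob_space ?Q
    by (rule prob_space_PiM) (rule P)
  have u': "u \<in> borel_measurable P" "k \<in> borel_measurable P"
    using u k by (auto simp: has_bochner_integral_iff)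
  have "Q.indep_vars (\<lambda>_. P) (\<lambda>i \<zeta>. \<zeta> i) I"
    using st P by (intro indep_vars_PiM_components) auto
  from Q.indep_vars_imp_indep_var[OF this st]
  have ind: "Q.indep_var P (\<lambda>\<zeta>. \<zeta> s) P (\<lambda>\<zeta>. \<zeta> t)" .
  have 1: "has_bochner_integral ?Q (\<lambda>\<zeta>. k (\<zeta> s) \<bullet> e) (integral\<^sup>L P k \<bullet> e)" for e
    using has_bochner_integral_PiM_component[OF P st(1) has_bochner_integral_integrable[OF k]]
    by (rule has_bochner_integral_inner_left)
  have 2: "has_bochner_integral ?Q (\<lambda>\<zeta>. u (\<zeta> t) \<bullet> e) 0" for e
    using has_bochner_integral_inner_left[OF has_bochner_integral_PiM_component[OF P st(2) u], of e] by simp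
  have "has_bochner_integral ?Q (\<lambda>\<zeta>. (k (\<zeta> s) \<bullet> e) * (u (\<zeta> t) \<bullet> e)) 0" for e
  proof -
    have "Q.indep_var borel ((\<lambda>z. k z \<bullet> e) \<circ> (\<lambda>\<zeta>. \<zeta> s)) borel ((\<lambda>z. u z \<bullet> e) \<circ> (\<lambda>\<zeta>. \<zeta> t))"
      by (rule Q.indep_var_compose[OF ind]) (use u' in measurable)
    then have *: "Q.indep_var borel (\<lambda>\<zeta>. k (\<zeta> s) \<bullet> e) borel (\<lambda>\<zeta>. u (\<zeta> t) \<bullet> e)"
      by (simp add: comp_def)
    show ?thesis
      using Q.indep_var_integrable[OF *] Q.indep_var_lebesgue_integral[OF *] 1[of e] 2[of e]
      by (simp add: has_bochner_integral_iff)
  qed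
  then have "has_bochner_integral ?Q (\<lambda>\<zeta>. \<Sum>e\<in>Basis. (k (\<zeta> s) \<bullet> e) * (u (\<zeta> t) \<bullet> e)) (\<Sum>e\<in>(Basis::'v set). 0)"
    by (intro has_bochner_integral_sum)
  then show ?thesis
    by (simp add: euclidean_inner[symmetric])
qed

section \<open>The loss averaged over a batch\<close>

text \<open>The values lie in an arbitrary real vector space, so that one definition averages both
  the loss and its gradient.\<close>

definition batch_mean :: "nat \<Rightarrow> ('w \<Rightarrow> 'z \<Rightarrow> 'v::real_vector) \<Rightarrow> 'w \<Rightarrow> (nat \<Rightarrow> 'z) \<Rightarrow> 'v" where
  "batch_mean b h w \<zeta> = (1 / real b) *\<^sub>R (\<Sum>s=1..b. h w (\<zeta> s))"

lemma convex_on_setsum: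
  assumes "finite I" "convex W" "\<And>i. i \<in> I \<Longrightarrow> convex_on W (f i)"
  shows "convex_on W (\<lambda>w. \<Sum>i\<in>I. f i w)"
  using assms(1,3)
proof (induction I rule: finite_induct)
  case empty
  then show ?case by (simp add: convex_on_def assms(2))
next
  case (insert i I)
  then show ?case by (simp add: convex_on_add)
qed

text \<open>Convexity and the derivative pass to sums and multiples. The factor \<open>1 / b\<close>
  cancels the \<open>b\<close> equal Lipschitz bounds, so \<open>L\<close> is unchanged.\<close>

lemma convex_smooth_loss_batch_mean:
  assumes fg: "convex_smooth_loss W L \<Z> f g" and "convex W" "1 \<le> b"
  shows "convex_smooth_loss W L (PiE {1..b} (\<lambda>_. \<Z>)) (batch_mean b f) (batch_mean b g)"
  unfolding convex_smooth_loss_def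
proof (intro ballI conjI)
  fix \<zeta>
  assume "\<zeta> \<in> PiE {1..b} (\<lambda>_. \<Z>)"
  then have \<zeta>: "\<zeta> s \<in> \<Z>" if "s \<in> {1..b}" for s
    using that by auto
  show "convex_on W (\<lambda>w. batch_mean b f w \<zeta>)"
    unfolding batch_mean_def real_scaleR_def
    using fg \<zeta> \<open>convex W\<close>
    by (intro convex_on_cmul convex_on_setsum) (auto simp: convex_smooth_loss_def)
  show "gradient_on W (\<lambda>w. batch_mean b f w \<zeta>) (\<lambda>w. batch_mean b g w \<zeta>)"
    unfolding gradient_on_def
  proof
    fix w assume "w \<in> W"
    then have "((\<lambda>w. f w (\<zeta> s)) has_derivative (\<lambda>h. g w (\<zeta> s) \<bullet> h)) (at w within W)" if "s \<in> {1..b}" for s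
      using fg \<zeta>[OF that] by (auto simp: convex_smooth_loss_def gradient_on_def)
    then have "((\<lambda>w. batch_mean b f w \<zeta>) has_derivative
        (\<lambda>h. (1 / real b) *\<^sub>R (\<Sum>s=1..b. g w (\<zeta> s) \<bullet> h))) (at w within W)"
      unfolding batch_mean_def by (intro has_derivative_scaleR_right has_derivative_sum)
    then show "((\<lambda>w. batch_mean b f w \<zeta>) has_derivative (\<lambda>h. batch_mean b g w \<zeta> \<bullet> h)) (at w within W)"
      by (simp add: batch_mean_def inner_sum_left)
  qed
  fix w w' assume w: "w \<in> W" "w' \<in> W"
  have "norm (batch_mean b g w \<zeta> - batch_mean b g w' \<zeta>)
      = 1 / real b * norm (\<Sum>s=1..b. g w (\<zeta> s) - g w' (\<zeta> s))"
    by (simp add: batch_mean_def scaleR_diff_right[symmetric] sum_subtractf)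
  also have "\<dots> \<le> 1 / real b * (\<Sum>s=1..b. L * norm (w - w'))"
    using fg \<zeta> w by (intro mult_left_mono sum_norm_le) (auto simp: convex_smooth_loss_def)
  also have "\<dots> = L * norm (w - w')"
    using \<open>1 \<le> b\<close> by simp
  finally show "norm (batch_mean b g w \<zeta> - batch_mean b g w' \<zeta>) \<le> L * norm (w - w')" .
qed

lemma has_bochner_integral_batch_mean:
  fixes h :: "'w \<Rightarrow> 'z \<Rightarrow> 'v::{banach, second_countable_topology}"
  assumes "prob_space P" "1 \<le> b" "has_bochner_integral P (h w) c"
  shows "has_bochner_integral (PiM {1..b} (\<lambda>_. P)) (batch_mean b h w) c"
proof -
  have "has_bochner_integral (PiM {1..b} (\<lambda>_. P)) (\<lambda>\<zeta>. (1 / real b) *\<^sub>R (\<Sum>s=1..b. h w (\<zeta> s)))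
     ((1 / real b) *\<^sub>R (\<Sum>s=1..b. c))"
    by (intro has_bochner_integral_scaleR_right has_bochner_integral_sum
        has_bochner_integral_PiM_component) (use assms in auto)
  then show ?thesis
    using \<open>1 \<le> b\<close> by (simp add: batch_mean_def[abs_def] sum_constant_scaleR)
qed

text \<open>The serial bound only covers losses with the given expectation \<open>F\<close>; the
  averaged loss qualifies by linearity.\<close>

lemma has_expected_loss_batch_mean:
  assumes "prob_space P" "1 \<le> b" "has_expected_loss W P f g F gradF"
  shows "has_expected_loss W (PiM {1..b} (\<lambda>_. P)) (batch_mean b f) (batch_mean b g) F gradF"
proof -
  have "has_bochner_integral (PiM {1..b} (\<lambda>_. P)) (batch_mean b f w) (F w)"
    and "has_bochner_integral (PiM {1..b} (\<lambda>_. P)) (batch_mean b g w) (gradF w)" if "w \<in> W" for w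
    using that assms by (auto simp only: has_expected_loss_def intro!: has_bochner_integral_batch_mean)
  then show ?thesis
    using assms(3) by (simp add: has_expected_loss_def)
qed

text \<open>Expand the squared norm of the averaged deviation into a double sum. The cross terms
  have mean zero, and \<open>b\<close> diagonal terms divided by the square of \<open>b\<close>
  leave a single factor \<open>1 / b\<close>.\<close>

lemma bounded_variance_batch_mean:
  assumes P: "prob_space P" and "1 \<le> b" and EF: "has_expected_loss W P f g F gradF"
    and var: "bounded_variance W P g gradF v"
  shows "bounded_variance W (PiM {1..b} (\<lambda>_. P)) (batch_mean b g) gradF (v / real b)"
  unfolding bounded_variance_def
proof
  fix w assume w: "w \<in> W"
  interpret prob_space P by (rule P)
  define u where "u z = g w z - gradF w" for z
  define c where "c = (\<integral>z. (norm (u z))\<^sup>2 \<partial>P)"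
  have u: "has_bochner_integral P u 0"
    using EF w by (auto simp: u_def[abs_def] has_expected_loss_def has_bochner_integral_iff prob_space)
  have c: "has_bochner_integral P (\<lambda>z. u z \<bullet> u z) c" "c \<le> v"
    using var w by (auto simp: c_def u_def[abs_def] bounded_variance_def has_bochner_integral_iff power2_norm_eq_inner)
  have "has_bochner_integral (PiM {1..b} (\<lambda>_. P)) (\<lambda>\<zeta>. u (\<zeta> s) \<bullet> u (\<zeta> t)) (if s = t then c else 0)"
    if "s \<in> {1..b}" "t \<in> {1..b}" for s t
    using has_bochner_integral_inner_components[OF P that _ _ u, of u]
      has_bochner_integral_PiM_component[OF P that(1) c(1)] u
    by (auto simp: has_bochner_integral_iff)
  then have "has_bochner_integral (PiM {1..b} (\<lambda>_. P))
      (\<lambda>\<zeta>. (1 / (real b)\<^sup>2) * (\<Sum>s=1..b. \<Sum>t=1..b. u (\<zeta> s) \<bullet> u (\<zeta> t)))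
      ((1 / (real b)\<^sup>2) * (\<Sum>s=1..b. \<Sum>t=1..b. if s = t then c else 0))"
    by (intro has_bochner_integral_mult_right has_bochner_integral_sum)
  moreover have "(1 / (real b)\<^sup>2) * (\<Sum>s=1..b. \<Sum>t=1..b. u (\<zeta> s) \<bullet> u (\<zeta> t))
      = (norm (batch_mean b g w \<zeta> - gradF w))\<^sup>2" for \<zeta>
  proof -
    have "batch_mean b g w \<zeta> - gradF w = (1 / real b) *\<^sub>R (\<Sum>s=1..b. u (\<zeta> s))"
      using \<open>1 \<le> b\<close> by (simp add: batch_mean_def u_def sum_subtractf scaleR_diff_right sum_constant_scaleR)
    then have "(norm (batch_mean b g w \<zeta> - gradF w))\<^sup>2 = (1 / real b)\<^sup>2 * (norm (\<Sum>s=1..b. u (\<zeta> s)))\<^sup>2"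
      by (simp add: power_mult_distrib power_divide)
    also have "(norm (\<Sum>s=1..b. u (\<zeta> s)))\<^sup>2 = (\<Sum>s=1..b. \<Sum>t=1..b. u (\<zeta> s) \<bullet> u (\<zeta> t))"
      by (simp add: power2_norm_eq_inner inner_sum_left inner_sum_right) (rule sum.swap)
    finally show ?thesis
      by (simp add: power_divide)
  qed
  moreover have "(1 / (real b)\<^sup>2) * (\<Sum>s=1..b. \<Sum>t=1..b. if s = t then c else 0) = c / real b"
    using \<open>1 \<le> b\<close> by (simp add: power2_eq_square)
  ultimately have "has_bochner_integral (PiM {1..b} (\<lambda>_. P))
      (\<lambda>\<zeta>. (norm (batch_mean b g w \<zeta> - gradF w))\<^sup>2) (c / real b)"
    by (simp only:)
  moreover have "c / real b \<le> v / real b"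
    using c by (intro divide_right_mono) auto
  ultimately show "integrable (PiM {1..b} (\<lambda>_. P)) (\<lambda>\<zeta>. (norm (batch_mean b g w \<zeta> - gradF w))\<^sup>2) \<and>
      (\<integral>\<zeta>. (norm (batch_mean b g w \<zeta> - gradF w))\<^sup>2 \<partial>PiM {1..b} (\<lambda>_. P)) \<le> v / real b"
    by (auto simp: has_bochner_integral_iff)
qed

section \<open>Integrability of a single term from that of the sum\<close>

text \<open>
  Multiply the sum by \<open>sgn (u (\<zeta> s))\<close>: all terms but the one at \<open>s\<close> have mean zero.
\<close>

lemma expectation_abs_le_abs_sum:
  fixes u :: "'z \<Rightarrow> real"
  assumes P: "prob_space P" and "finite I" "s \<in> I" and u: "has_bochner_integral P u 0"
  shows "(\<integral>z. \<bar>u z\<bar> \<partial>P) \<le> (\<integral>\<zeta>. \<bar>\<Sum>t\<in>I. u (\<zeta> t)\<bar> \<partial>PiM I (\<lambda>_. P))"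
proof -
  let ?Q = "PiM I (\<lambda>_. P)"
  interpret prob_space P by (rule P)
  have [measurable]: "u \<in> borel_measurable P" and int_u: "integrable P u"
    using u by (auto simp: has_bochner_integral_iff)
  define c where "c = (\<integral>z. \<bar>u z\<bar> \<partial>P)"
  have c: "has_bochner_integral P (\<lambda>z. sgn (u z) * u z) c"
  proof -
    have "(\<lambda>z. sgn (u z) * u z) = (\<lambda>z. \<bar>u z\<bar>)"
      by (simp add: fun_eq_iff sgn_real_def)
    then show ?thesis
      using int_u by (simp add: c_def has_bochner_integral_iff)
  qed
  have sgn: "integrable P (\<lambda>z. sgn (u z))"
    by (rule integrable_const_bound[of _ 1]) (auto simp: sgn_real_def)
  \<comment> \<open>On the reals the inner product is multiplication, so the lemma on inner products
    applies with the sign of \<open>u\<close> as \<open>k\<close>.\<close>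
  have "has_bochner_integral ?Q (\<lambda>\<zeta>. sgn (u (\<zeta> s)) * u (\<zeta> t)) (if t = s then c else 0)"
    if "t \<in> I" for t
    using has_bochner_integral_inner_components[OF P \<open>s \<in> I\<close> that _ sgn u]
      has_bochner_integral_PiM_component[OF P \<open>s \<in> I\<close> c] by auto
  then have "has_bochner_integral ?Q (\<lambda>\<zeta>. \<Sum>t\<in>I. sgn (u (\<zeta> s)) * u (\<zeta> t))
      (\<Sum>t\<in>I. if t = s then c else 0)"
    by (rule has_bochner_integral_sum)
  then have "has_bochner_integral ?Q (\<lambda>\<zeta>. sgn (u (\<zeta> s)) * (\<Sum>t\<in>I. u (\<zeta> t))) c"
    using assms(2,3) by (simp add: sum_distrib_left)
  moreover have "integrable ?Q (\<lambda>\<zeta>. \<bar>\<Sum>t\<in>I. u (\<zeta> t)\<bar>)"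
    by (intro integrable_abs Bochner_Integration.integrable_sum
        integrable.intros[OF has_bochner_integral_PiM_component[OF P _ u]])
  moreover have "sgn x * y \<le> \<bar>y\<bar>" for x y :: real
    by (auto simp: sgn_real_def)
  ultimately show ?thesis
    unfolding c_def[symmetric] by (auto simp: has_bochner_integral_iff intro!: integral_mono)
qed

text \<open>For fixed \<open>x\<close> the terms are i.i.d. with mean \<open>\<mu> x\<close>. The
  absolute mean of one centred term is at most that of the centred sum, which bounds a single term
  by the sum up to a multiple of \<open>\<bar>\<mu> x\<bar>\<close>. Integrating this over
  \<open>x\<close> and applying Fubini gives the claim.\<close>

lemma has_bochner_integral_single_of_sum:
  fixes h :: "'x \<Rightarrow> 'z \<Rightarrow> real"
  assumes Q: "prob_space Q" and P: "prob_space P" and I: "finite I" "s \<in> I"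
    and h: "(\<lambda>(x, z). h x z) \<in> borel_measurable (Q \<Otimes>\<^sub>M P)"
    and mean: "\<And>x. x \<in> space Q \<Longrightarrow> has_bochner_integral P (h x) (\<mu> x)"
    and int: "integrable (Q \<Otimes>\<^sub>M PiM I (\<lambda>_. P)) (\<lambda>(x, \<zeta>). \<Sum>t\<in>I. h x (\<zeta> t))"
  shows "has_bochner_integral (Q \<Otimes>\<^sub>M PiM I (\<lambda>_. P)) (\<lambda>(x, \<zeta>). h x (\<zeta> s)) (\<integral>x. \<mu> x \<partial>Q)"
proof -
  let ?R = "PiM I (\<lambda>_. P)"
  let ?n = "real (card I)"
  interpret Q: prob_space Q by (rule Q)
  interpret P: prob_space P by (rule P)
  interpret R: prob_space ?R by (rule prob_space_PiM) (rule P)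
  interpret QR: pair_sigma_finite Q ?R ..
  have n: "?n > 0"
    using I by (auto simp: card_gt_0_iff)
  note [measurable] = h
  have comp: "has_bochner_integral ?R (\<lambda>\<zeta>. h x (\<zeta> t)) (\<mu> x)" if "x \<in> space Q" "t \<in> I" for x t
    by (rule has_bochner_integral_PiM_component[OF P that(2) mean[OF that(1)]])
  have sum: "has_bochner_integral ?R (\<lambda>\<zeta>. \<Sum>t\<in>I. h x (\<zeta> t)) (?n * \<mu> x)" if "x \<in> space Q" for x
    using has_bochner_integral_sum[OF comp[OF that], of I "\<lambda>t. t"] by simp
  \<comment> \<open>Integrating out the samples turns the integrable sum into
    \<open>?n * \<mu> x\<close>, whence \<open>\<mu>\<close> is integrable.\<close>
  have "integrable Q (\<lambda>x. \<integral>\<zeta>. (\<Sum>t\<in>I. h x (\<zeta> t)) \<partial>?R)"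
    using QR.integrable_fst'[OF int] by simp
  then have "integrable Q (\<lambda>x. ?n * \<mu> x)"
    by (rule Bochner_Integration.integrable_cong[THEN iffD1, rotated -1])
       (auto simp: has_bochner_integral_integral_eq[OF sum])
  then have \<mu>: "integrable Q \<mu>"
    using n by simp
  \<comment> \<open>In the constant \<open>?n + 1\<close>, the 1 pays for centring the single term
    and \<open>?n\<close> for centring the sum.\<close>
  have abs_bound: "(\<integral>\<zeta>. \<bar>h x (\<zeta> s)\<bar> \<partial>?R) \<le> (\<integral>\<zeta>. \<bar>\<Sum>t\<in>I. h x (\<zeta> t)\<bar> \<partial>?R) + (?n + 1) * \<bar>\<mu> x\<bar>"
    if x: "x \<in> space Q" for x
  proof -
    define u where "u z = h x z - \<mu> x" for z
    have u: "has_bochner_integral P u 0"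
      using mean[OF x] unfolding u_def[abs_def]
      by (auto simp: has_bochner_integral_iff P.prob_space)
    have hx: "has_bochner_integral P (\<lambda>z. \<bar>h x z\<bar>) (\<integral>z. \<bar>h x z\<bar> \<partial>P)"
      using mean[OF x] by (auto simp: has_bochner_integral_iff)
    have "(\<integral>\<zeta>. \<bar>h x (\<zeta> s)\<bar> \<partial>?R) = (\<integral>z. \<bar>h x z\<bar> \<partial>P)"
      using has_bochner_integral_PiM_component[OF P I(2) hx] by (rule has_bochner_integral_integral_eq)
    also have "\<dots> \<le> (\<integral>z. \<bar>u z\<bar> + \<bar>\<mu> x\<bar> \<partial>P)"
      using mean[OF x] u by (intro integral_mono) (auto simp: has_bochner_integral_iff u_def)
    also have "\<dots> = (\<integral>z. \<bar>u z\<bar> \<partial>P) + \<bar>\<mu> x\<bar>"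
      using u by (simp add: has_bochner_integral_iff P.prob_space)
    also have "(\<integral>z. \<bar>u z\<bar> \<partial>P) \<le> (\<integral>\<zeta>. \<bar>\<Sum>t\<in>I. u (\<zeta> t)\<bar> \<partial>?R)"
      by (rule expectation_abs_le_abs_sum[OF P I u])
    also have "\<dots> = (\<integral>\<zeta>. \<bar>(\<Sum>t\<in>I. h x (\<zeta> t)) - ?n * \<mu> x\<bar> \<partial>?R)"
      by (simp add: u_def sum_subtractf)
    also have "\<dots> \<le> (\<integral>\<zeta>. \<bar>\<Sum>t\<in>I. h x (\<zeta> t)\<bar> + ?n * \<bar>\<mu> x\<bar> \<partial>?R)"
      using sum[OF x] n
      by (intro integral_mono) (auto simp: has_bochner_integral_iff abs_mult intro: order_trans[OF abs_triangle_ineq4])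
    also have "\<dots> = (\<integral>\<zeta>. \<bar>\<Sum>t\<in>I. h x (\<zeta> t)\<bar> \<partial>?R) + ?n * \<bar>\<mu> x\<bar>"
      using sum[OF x] by (simp add: has_bochner_integral_iff R.prob_space)
    finally show ?thesis
      by (simp add: algebra_simps)
  qed
  have s_meas: "(\<lambda>(x, \<zeta>). h x (\<zeta> s)) \<in> borel_measurable (Q \<Otimes>\<^sub>M ?R)"
    using I(2) by measurable
  have "integrable Q (\<lambda>x. (\<integral>\<zeta>. \<bar>\<Sum>t\<in>I. h x (\<zeta> t)\<bar> \<partial>?R) + (?n + 1) * \<bar>\<mu> x\<bar>)"
    using QR.integrable_fst'[OF integrable_abs[OF int]] \<mu> by simp
  moreover have "(\<lambda>x. \<integral>\<zeta>. \<bar>h x (\<zeta> s)\<bar> \<partial>?R) \<in> borel_measurable Q"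
    using I(2) by measurable
  ultimately have "integrable Q (\<lambda>x. \<integral>\<zeta>. \<bar>h x (\<zeta> s)\<bar> \<partial>?R)"
    by (rule Bochner_Integration.integrable_bound)
       (use abs_bound in \<open>auto intro!: AE_I2 intro: order_trans[OF _ abs_ge_self]\<close>)
  then have int_s: "integrable (Q \<Otimes>\<^sub>M ?R) (\<lambda>(x, \<zeta>). h x (\<zeta> s))"
    using comp I(2)
    by (intro QR.Fubini_integrable[OF s_meas]) (auto simp: has_bochner_integral_iff intro!: AE_I2)
  have "(\<integral>p. (case p of (x, \<zeta>) \<Rightarrow> h x (\<zeta> s)) \<partial>(Q \<Otimes>\<^sub>M ?R)) = (\<integral>x. (\<integral>\<zeta>. h x (\<zeta> s) \<partial>?R) \<partial>Q)"
    using QR.integral_fst'[OF int_s] by simp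
  also have "\<dots> = (\<integral>x. \<mu> x \<partial>Q)"
    using comp[OF _ I(2)] by (intro Bochner_Integration.integral_cong) (auto simp: has_bochner_integral_iff)
  finally show ?thesis
    using int_s by (simp add: has_bochner_integral_iff)
qed

section \<open>Blocks of i.i.d. samples\<close>

lemma iid_samples_measurable:
  assumes "prob_space M" "iid_samples M P Z" "i \<ge> 1"
  shows "Z i \<in> M \<rightarrow>\<^sub>M P"
  using assms by (auto simp: iid_samples_def prob_space.indep_vars_def)

lemma iid_samples_distr_PiM:
  assumes M: "prob_space M" and Z: "iid_samples M P Z" and I: "I \<subseteq> {1..}" "I \<noteq> {}"
  shows "distr M (PiM I (\<lambda>_. P)) (\<lambda>\<omega>. \<lambda>i\<in>I. Z i \<omega>) = PiM I (\<lambda>_. P)"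
proof -
  interpret prob_space M by (rule M)
  have rv: "Z i \<in> M \<rightarrow>\<^sub>M P" if "i \<in> I" for i
    using iid_samples_measurable[OF M Z] that I by auto
  have "indep_vars (\<lambda>_. P) Z I"
    using Z by (intro indep_vars_subset[OF _ I(1)]) (simp add: iid_samples_def)
  then have "distr M (PiM I (\<lambda>_. P)) (\<lambda>\<omega>. \<lambda>i\<in>I. Z i \<omega>) = (\<Pi>\<^sub>M i\<in>I. distr M P (Z i))"
    using indep_vars_iff_distr_eq_PiM'[OF I(2) rv] by simp
  also have "\<dots> = PiM I (\<lambda>_. P)"
    using Z I by (intro PiM_cong) (auto simp: iid_samples_def)
  finally show ?thesis .
qed

text \<open>The restriction to \<open>{1..b}\<close> makes a block a point of the product space
  \<open>PiM {1..b} (\<lambda>_. P)\<close>. By truncated subtraction index 0 would repeat block 1;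
  blocks are numbered from 1.\<close>

definition block :: "nat \<Rightarrow> (nat \<Rightarrow> 'z) \<Rightarrow> nat \<Rightarrow> nat \<Rightarrow> 'z" where
  "block b z j = (\<lambda>s\<in>{1..b}. z ((j - 1) * b + s))"

text \<open>Blocks are functions of samples with pairwise disjoint index sets, hence independent.
  The law of a block is a product measure reindexed by a shift.\<close>

lemma iid_samples_block:
  assumes M: "prob_space M" and P: "prob_space P" and Z: "iid_samples M P Z" and b: "1 \<le> b"
  shows "iid_samples M (PiM {1..b} (\<lambda>_. P)) (\<lambda>j \<omega>. block b (\<lambda>i. Z i \<omega>) j)"
proof -
  interpret prob_space M by (rule M)
  define K where "K j = {(j - 1) * b + 1..(j - 1) * b + b}" for j
  define Y where "Y j x = (\<lambda>s\<in>{1..b}. x ((j - 1) * b + s))" for j and x :: "nat \<Rightarrow> 'b"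
  have idx: "(j - 1) * b + s \<in> K j" if "s \<in> {1..b}" for j s
    using that by (auto simp: K_def)
  have Y: "Y j \<in> PiM (K j) (\<lambda>_. P) \<rightarrow>\<^sub>M PiM {1..b} (\<lambda>_. P)" for j
    unfolding Y_def by (intro measurable_restrict measurable_component_singleton idx)
  have block_eq: "(\<lambda>\<omega>. Y j (\<lambda>i\<in>K j. Z i \<omega>)) = (\<lambda>\<omega>. block b (\<lambda>i. Z i \<omega>) j)" for j
    using idx by (fastforce simp: Y_def block_def fun_eq_iff)
  have disj: "disjoint_family_on K {1..}"
  proof (unfold disjoint_family_on_def, intro ballI impI)
    fix i j :: nat assume ij: "i \<in> {1..}" "j \<in> {1..}" "i \<noteq> j"
    have "x \<notin> K i \<inter> K j" for x
    proof
      assume x: "x \<in> K i \<inter> K j"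
      \<comment> \<open>A sample index determines the number of its block, so index sets of
        different blocks cannot meet.\<close>
      have "(x - 1) div b = k - 1" if "x \<in> K k" for k
        using that b by (intro div_nat_eqI) (auto simp: K_def algebra_simps)
      then have "i - 1 = j - 1"
        using x by (metis IntD1 IntD2)
      with ij show False by auto
    qed
    then show "K i \<inter> K j = {}" by blast
  qed
  have "indep_vars (\<lambda>j. PiM (K j) (\<lambda>_. P)) (\<lambda>j \<omega>. \<lambda>i\<in>K j. Z i \<omega>) {1..}"
    using Z disj
    by (intro indep_vars_restrict[of _ _ "{1..}"]) (simp_all add: iid_samples_def, auto simp: K_def)
  from indep_vars_compose2[OF this Y]
  have "indep_vars (\<lambda>_. PiM {1..b} (\<lambda>_. P)) (\<lambda>j \<omega>. block b (\<lambda>i. Z i \<omega>) j) {1..}"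
    by (simp add: block_eq)
  moreover have "distr M (PiM {1..b} (\<lambda>_. P)) (\<lambda>\<omega>. block b (\<lambda>i. Z i \<omega>) j) = PiM {1..b} (\<lambda>_. P)"
    if "j \<ge> 1" for j
  proof -
    have K: "K j \<subseteq> {1..}" "K j \<noteq> {}"
      using b by (auto simp: K_def)
    have rv: "(\<lambda>\<omega>. \<lambda>i\<in>K j. Z i \<omega>) \<in> M \<rightarrow>\<^sub>M PiM (K j) (\<lambda>_. P)"
      using iid_samples_measurable[OF M Z] K by (intro measurable_restrict) auto
    have "distr M (PiM {1..b} (\<lambda>_. P)) (\<lambda>\<omega>. block b (\<lambda>i. Z i \<omega>) j)
        = distr (distr M (PiM (K j) (\<lambda>_. P)) (\<lambda>\<omega>. \<lambda>i\<in>K j. Z i \<omega>)) (PiM {1..b} (\<lambda>_. P)) (Y j)"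
      by (subst distr_distr[OF Y rv]) (simp add: comp_def block_eq)
    also have "\<dots> = distr (PiM (K j) (\<lambda>_. P)) (PiM {1..b} (\<lambda>_. P)) (Y j)"
      by (simp add: iid_samples_distr_PiM[OF M Z K])
    also have "\<dots> = PiM {1..b} (\<lambda>_. P)"
      unfolding Y_def using P idx
      by (intro distr_PiM_reindex[where M="\<lambda>_. P" and f="\<lambda>s. (j - 1) * b + s" and K="K j"])
        (auto simp: inj_on_def)
    finally show ?thesis .
  qed
  ultimately show ?thesis
    by (auto simp: iid_samples_def)
qed

section \<open>Predictions as random variables\<close>

lemma state_cong:
  assumes "\<And>j. 1 \<le> j \<Longrightarrow> j \<le> k \<Longrightarrow> G j = G' j"
  shows "state \<phi> \<alpha> s G k = state \<phi> \<alpha> s G' k"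
  using assms
proof (induction k)
  case (Suc k)
  then have "state \<phi> \<alpha> s G k = state \<phi> \<alpha> s G' k" "G (Suc k) = G' (Suc k)"
    by simp_all
  then show ?case
    by simp
qed simp

text \<open>Allows the state to be read as a function on a finite product of sample spaces, as
  measurability and independence arguments require.\<close>

lemma state_serial_gradient_restrict:
  assumes "{1..k} \<subseteq> J"
  shows "state \<phi> \<alpha> s (serial_gradient g (restrict z J)) k = state \<phi> \<alpha> s (serial_gradient g z) k"
  using assms by (intro state_cong) (auto simp: serial_gradient_def fun_eq_iff)

text \<open>Induction along the steps. The target carries \<open>restrict_space borel W\<close>
  because the gradient is known to be jointly measurable only on \<open>W\<close>.\<close>

lemma measurable_state:
  fixes g :: "'w::euclidean_space \<Rightarrow> 'z \<Rightarrow> 'w"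
  assumes upd: "update_rule W A \<phi>" and w1: "w1 \<in> W" and a1: "a1 \<in> space A"
    and g: "(\<lambda>(w, z). g w z) \<in> borel_measurable (restrict_space borel W \<Otimes>\<^sub>M P)"
  shows "(\<lambda>\<zeta>. state \<phi> \<alpha> (w1, a1) (serial_gradient g \<zeta>) k)
    \<in> PiM {1..k} (\<lambda>_. P) \<rightarrow>\<^sub>M restrict_space borel W \<Otimes>\<^sub>M A"
proof (induction k)
  case 0
  then show ?case
    using w1 a1 by (simp add: space_pair_measure space_restrict_space)
next
  case (Suc k)
  let ?N = "PiM {1..Suc k} (\<lambda>_. P)"
  let ?S = "\<lambda>\<zeta>. state \<phi> \<alpha> (w1, a1) (serial_gradient g \<zeta>)"
  have "(\<lambda>\<zeta>. ?S (restrict \<zeta> {1..k}) k) \<in> ?N \<rightarrow>\<^sub>M restrict_space borel W \<Otimes>\<^sub>M A"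
    by (rule measurable_compose[OF measurable_restrict_subset Suc.IH]) auto
  then have S: "(\<lambda>\<zeta>. ?S \<zeta> k) \<in> ?N \<rightarrow>\<^sub>M restrict_space borel W \<Otimes>\<^sub>M A"
    by (simp add: state_serial_gradient_restrict)
  have w: "(\<lambda>\<zeta>. fst (?S \<zeta> k)) \<in> ?N \<rightarrow>\<^sub>M restrict_space borel W"
    and a: "(\<lambda>\<zeta>. snd (?S \<zeta> k)) \<in> ?N \<rightarrow>\<^sub>M A"
    using measurable_compose[OF S measurable_fst] measurable_compose[OF S measurable_snd] by auto
  have z: "(\<lambda>\<zeta>. \<zeta> (Suc k)) \<in> ?N \<rightarrow>\<^sub>M P"
    by (rule measurable_component_singleton) simp
  have "(\<lambda>\<zeta>. g (fst (?S \<zeta> k)) (\<zeta> (Suc k))) \<in> borel_measurable ?N"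
    using measurable_compose[OF measurable_Pair[OF w z] g] by simp
  from measurable_Pair[OF a this]
  have "(\<lambda>\<zeta>. case (snd (?S \<zeta> k), g (fst (?S \<zeta> k)) (\<zeta> (Suc k))) of (a, v) \<Rightarrow> \<phi> a v (\<alpha> (Suc k)))
      \<in> ?N \<rightarrow>\<^sub>M borel \<Otimes>\<^sub>M A"
    by (rule measurable_compose) (use upd in \<open>simp add: update_rule_def\<close>)
  then have next_state: "(\<lambda>\<zeta>. ?S \<zeta> (Suc k)) \<in> ?N \<rightarrow>\<^sub>M borel \<Otimes>\<^sub>M A"
    by (simp add: case_prod_beta serial_gradient_def)
  \<comment> \<open>\<open>update_rule\<close> gives measurability only into \<open>borel\<close>;
    that the prediction stays in \<open>W\<close> sharpens the target space for the next
    step.\<close>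
  have "fst (?S \<zeta> (Suc k)) \<in> W" if "\<zeta> \<in> space ?N" for \<zeta>
    using measurable_space[OF a that] upd
    by (simp add: case_prod_beta update_rule_def)
  then have "(\<lambda>\<zeta>. fst (?S \<zeta> (Suc k))) \<in> ?N \<rightarrow>\<^sub>M restrict_space borel W"
    using measurable_compose[OF next_state measurable_fst] by (intro measurable_restrict_space2) auto
  moreover have "(\<lambda>\<zeta>. snd (?S \<zeta> (Suc k))) \<in> ?N \<rightarrow>\<^sub>M A"
    by (rule measurable_compose[OF next_state measurable_snd])
  ultimately have "(\<lambda>\<zeta>. (fst (?S \<zeta> (Suc k)), snd (?S \<zeta> (Suc k)))) \<in> ?N \<rightarrow>\<^sub>M restrict_space borel W \<Otimes>\<^sub>M A"
    by (rule measurable_Pair)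
  then show ?case
    by (simp only: prod.collapse)
qed

text \<open>The prediction in step \<open>j\<close> is a function of the first \<open>j - 1\<close>
  samples and therefore independent of sample \<open>j\<close>, whose law is
  \<open>P\<close>.\<close>

lemma distr_prediction_sample:
  fixes g :: "'w::euclidean_space \<Rightarrow> 'z \<Rightarrow> 'w" and \<alpha> :: "nat \<Rightarrow> 'p"
  assumes M: "prob_space M" and Y: "iid_samples M P Y" and "1 \<le> j"
    and upd: "update_rule W A \<phi>" "w1 \<in> W" "a1 \<in> space A"
    and g: "(\<lambda>(w, z). g w z) \<in> borel_measurable (restrict_space borel W \<Otimes>\<^sub>M P)"
  defines "X \<equiv> \<lambda>\<omega>. prediction \<phi> \<alpha> (w1, a1) (serial_gradient g (\<lambda>i. Y i \<omega>)) j"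
  shows "X \<in> M \<rightarrow>\<^sub>M restrict_space borel W"
    and "distr M (restrict_space borel W \<Otimes>\<^sub>M P) (\<lambda>\<omega>. (X \<omega>, Y j \<omega>))
      = distr M (restrict_space borel W) X \<Otimes>\<^sub>M P"
proof -
  interpret prob_space M by (rule M)
  define S where "S \<zeta> = fst (state \<phi> \<alpha> (w1, a1) (serial_gradient g \<zeta>) (j - 1))" for \<zeta>
  have S: "S \<in> PiM {1..j - 1} (\<lambda>_. P) \<rightarrow>\<^sub>M restrict_space borel W"
    unfolding S_def[abs_def]
    by (rule measurable_compose[OF measurable_state[OF upd g] measurable_fst])
  have X: "X \<omega> = S (\<lambda>i\<in>{1..j - 1}. Y i \<omega>)" for \<omega>
    by (simp add: X_def S_def prediction_def state_serial_gradient_restrict)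
  let ?B = "restrict_space borel W"
  \<comment> \<open>Independence is available for restrictions to disjoint index sets, so sample
    \<open>j\<close> first appears as a point of a one-factor product and is then read off as its
    coordinate.\<close>
  let ?J = "PiM {1..j - 1} (\<lambda>_. P)" and ?K = "PiM {j} (\<lambda>_. P)"
  let ?U = "\<lambda>\<omega>. \<lambda>i\<in>{1..j - 1}. Y i \<omega>" and ?V = "\<lambda>\<omega>. \<lambda>i\<in>{j}. Y i \<omega>"
  have last: "(\<lambda>\<zeta>. \<zeta> j) \<in> ?K \<rightarrow>\<^sub>M P"
    by simp
  have "indep_var ?J ?U ?K ?V"
    using Y \<open>1 \<le> j\<close> by (intro indep_var_restrict[of _ _ "{1..}"]) (auto simp: iid_samples_def)
  then have U: "?U \<in> M \<rightarrow>\<^sub>M ?J" and V: "?V \<in> M \<rightarrow>\<^sub>M ?K"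
    and UV: "distr M ?J ?U \<Otimes>\<^sub>M distr M ?K ?V = distr M (?J \<Otimes>\<^sub>M ?K) (\<lambda>\<omega>. (?U \<omega>, ?V \<omega>))"
    unfolding indep_var_distribution_eq by blast+
  show XB: "X \<in> M \<rightarrow>\<^sub>M ?B"
    unfolding X[abs_def] by (rule measurable_compose[OF U S])
  have P: "distr M P (Y j) = P"
    using Y \<open>1 \<le> j\<close> by (simp add: iid_samples_def)
  have "prob_space P"
    using prob_space_distr[OF iid_samples_measurable[OF M Y \<open>1 \<le> j\<close>]] by (simp add: P)
  then interpret P: prob_space P .
  have V_last: "distr (distr M ?K ?V) P (\<lambda>\<zeta>. \<zeta> j) = P"
    using P by (subst distr_distr[OF last V]) (simp add: comp_def)
  have "distr M (?B \<Otimes>\<^sub>M P) (\<lambda>\<omega>. (X \<omega>, Y j \<omega>))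
      = distr (distr M (?J \<Otimes>\<^sub>M ?K) (\<lambda>\<omega>. (?U \<omega>, ?V \<omega>))) (?B \<Otimes>\<^sub>M P) (\<lambda>(x, y). (S x, y j))"
    using S last U V by (subst distr_distr) (auto simp: comp_def X[abs_def] case_prod_beta)
  also have "\<dots> = distr (distr M ?J ?U) ?B S \<Otimes>\<^sub>M distr (distr M ?K ?V) P (\<lambda>\<zeta>. \<zeta> j)"
    unfolding UV[symmetric] using S last P.sigma_finite_measure
    by (intro pair_measure_distr[symmetric]) (simp_all add: V_last)
  also have "distr (distr M ?J ?U) ?B S = distr M ?B X"
    by (subst distr_distr[OF S U]) (simp add: comp_def X[abs_def])
  finally show "distr M (?B \<Otimes>\<^sub>M P) (\<lambda>\<omega>. (X \<omega>, Y j \<omega>)) = distr M ?B X \<Otimes>\<^sub>M P"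
    by (simp only: V_last)
qed

section \<open>Reduction of the mini-batch algorithm to the serial one\<close>

lemma convex_smooth_loss_continuous_on:
  assumes "convex_smooth_loss W L \<Z> f g" "z \<in> \<Z>"
  shows "continuous_on W (\<lambda>w. f w z)" "continuous_on W (\<lambda>w. g w z)"
proof -
  show "continuous_on W (\<lambda>w. f w z)"
    using assms unfolding convex_smooth_loss_def gradient_on_def
    by (meson has_derivative_continuous_on)
  \<comment> \<open>\<open>lipschitz_on\<close> includes nonnegativity of the constant, while the
    sign of \<open>L\<close> is not prescribed.\<close>
  have "\<bar>L\<bar>-lipschitz_on W (\<lambda>w. g w z)"
  proof (rule lipschitz_onI)
    fix w w' assume "w \<in> W" "w' \<in> W"
    then have "norm (g w z - g w' z) \<le> L * norm (w - w')"
      using assms by (auto simp: convex_smooth_loss_def)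
    also have "\<dots> \<le> \<bar>L\<bar> * norm (w - w')"
      by (intro mult_right_mono) auto
    finally show "dist (g w z) (g w' z) \<le> \<bar>L\<bar> * dist w w'"
      by (simp add: dist_norm)
  qed simp
  then show "continuous_on W (\<lambda>w. g w z)"
    by (rule lipschitz_on_continuous_on)
qed

text \<open>Both functions are measurable in \<open>z\<close>, since they have expectations, and
  continuous in \<open>w\<close>.\<close>

lemma borel_measurable_loss_gradient:
  fixes f :: "'w::euclidean_space \<Rightarrow> 'z \<Rightarrow> real"
  assumes "convex_smooth_loss W L (space P) f g" "has_expected_loss W P f g F gradF"
  shows "(\<lambda>(w, z). f w z) \<in> borel_measurable (restrict_space borel W \<Otimes>\<^sub>M P)"
    and "(\<lambda>(w, z). g w z) \<in> borel_measurable (restrict_space borel W \<Otimes>\<^sub>M P)"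
  by (rule borel_measurable_caratheodory;
      use assms(2) convex_smooth_loss_continuous_on[OF assms(1)] in
        \<open>auto simp: has_expected_loss_def has_bochner_integral_iff\<close>)+

text \<open>This identity holds for every sample sequence, so the two algorithms make the same
  predictions pointwise.\<close>

lemma minibatch_gradient_eq_serial_gradient:
  "minibatch_gradient b g z = serial_gradient (batch_mean b g) (block b z)"
  by (simp add: fun_eq_iff minibatch_gradient_def serial_gradient_def batch_mean_def block_def)

lemma serial_regret_restrict:
  "serial_regret \<phi> \<alpha> s f g wstar (restrict z {1..}) m = serial_regret \<phi> \<alpha> s f g wstar z m"
  unfolding serial_regret_def prediction_def
  by (intro sum.cong refl) (subst state_serial_gradient_restrict, auto)

text \<open>The bound is stated on the canonical infinite product. The law of the whole sequence
  \<open>Y\<close> is that product measure, so integrability and expectation carry over.\<close>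

lemma serial_regret_bound_iid_samples:
  fixes Y :: "nat \<Rightarrow> 'o \<Rightarrow> 's"
  assumes bound: "serial_regret_bound TYPE('s) W L F gradF wstar \<phi> \<alpha> s \<psi>" and "0 \<le> v"
    and P: "prob_space P" "convex_smooth_loss W L (space P) f g"
      "has_expected_loss W P f g F gradF" "bounded_variance W P g gradF v"
    and M: "prob_space M" and Y: "iid_samples M P Y" and "1 \<le> m"
  shows "integrable M (\<lambda>\<omega>. serial_regret \<phi> (\<alpha> v) s f g wstar (\<lambda>j. Y j \<omega>) m)"
    and "(\<integral>\<omega>. serial_regret \<phi> (\<alpha> v) s f g wstar (\<lambda>j. Y j \<omega>) m \<partial>M) \<le> \<psi> v m"
proof -
  let ?N = "\<Pi>\<^sub>M i\<in>{1..}. P"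
  let ?r = "\<lambda>z. serial_regret \<phi> (\<alpha> v) s f g wstar z m"
  define T where "T \<omega> = (\<lambda>j\<in>{1..}. Y j \<omega>)" for \<omega>
  have r: "integrable ?N ?r" "(\<integral>z. ?r z \<partial>?N) \<le> \<psi> v m"
    using bound P \<open>0 \<le> v\<close> \<open>1 \<le> m\<close> unfolding serial_regret_bound_def by blast+
  have T: "T \<in> M \<rightarrow>\<^sub>M ?N"
    unfolding T_def using iid_samples_measurable[OF M Y] by (intro measurable_restrict) auto
  have law: "distr M ?N T = ?N"
    unfolding T_def by (rule iid_samples_distr_PiM[OF M Y]) auto
  have rT: "?r (T \<omega>) = ?r (\<lambda>j. Y j \<omega>)" for \<omega>
    unfolding T_def by (rule serial_regret_restrict)
  show "integrable M (\<lambda>\<omega>. ?r (\<lambda>j. Y j \<omega>))"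
    using integrable_distr[OF T, of ?r] r(1) unfolding law rT .
  show "(\<integral>\<omega>. ?r (\<lambda>j. Y j \<omega>) \<partial>M) \<le> \<psi> v m"
    using integral_distr[OF T, of ?r] r unfolding law rT by (simp add: has_bochner_integral_iff)
qed

text \<open>Converts sample numbers counted from 1 into indices counted from 0, where division with
  remainder by \<open>b\<close> gives block and position.\<close>

lemma nat_ceiling_divide_Suc:
  assumes "1 \<le> b"
  shows "nat \<lceil>real (Suc i) / real b\<rceil> = Suc (i div b)"
proof -
  have "i = b * (i div b) + i mod b" "i mod b < b"
    using assms by auto
  then have "b * (i div b) < Suc i" "Suc i \<le> b * (i div b) + b"
    by linarith+
  then have "real (b * (i div b)) < real (Suc i)" "real (Suc i) \<le> real (b * (i div b) + b)"
    by (simp_all only: of_nat_less_iff of_nat_le_iff)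
  then have "\<lceil>real (Suc i) / real b\<rceil> = int (Suc (i div b))"
    using assms by (intro ceiling_unique) (auto simp: field_simps)
  then show ?thesis
    by simp
qed

section \<open>The regret bound for mini-batches\<close>

theorem theorem3:
  fixes W :: "(real ^ 'n) set"
    and P :: "'z measure"
    and f :: "real ^ 'n \<Rightarrow> 'z \<Rightarrow> real"
    and g :: "real ^ 'n \<Rightarrow> 'z \<Rightarrow> real ^ 'n"
    and F :: "real ^ 'n \<Rightarrow> real"
    and gradF :: "real ^ 'n \<Rightarrow> real ^ 'n"
    and wstar w1 :: "real ^ 'n"
    and A :: "'a measure"
    and a1 :: 'a
    and \<phi> :: "'a \<Rightarrow> real ^ 'n \<Rightarrow> 'p \<Rightarrow> (real ^ 'n) \<times> 'a"
    and \<alpha> :: "real \<Rightarrow> nat \<Rightarrow> 'p"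
    and \<psi> :: "real \<Rightarrow> nat \<Rightarrow> real"
    and L \<sigma> :: real
    and M :: "'o measure"
    and Z :: "nat \<Rightarrow> 'o \<Rightarrow> 'z"
    and b m :: nat
  assumes "closed W" and "convex W"
    and "prob_space P"
    and "convex_smooth_loss W L (space P) f g"
    and "has_expected_loss W P f g F gradF"
    and "0 \<le> \<sigma>" and "bounded_variance W P g gradF (\<sigma>\<^sup>2)"
    and "is_arg_min F (\<lambda>w. w \<in> W) wstar"
    and "update_rule W A \<phi>" and "w1 \<in> W" and "a1 \<in> space A"
    and "\<And>v v' k k'. 0 \<le> v \<Longrightarrow> v \<le> v' \<Longrightarrow> 1 \<le> k \<Longrightarrow> k \<le> k' \<Longrightarrow> \<psi> v k \<le> \<psi> v' k'"
    and "serial_regret_bound TYPE(nat \<Rightarrow> 'z) W L F gradF wstar \<phi> \<alpha> (w1, a1) \<psi>"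
    and "prob_space M" and "iid_samples M P Z"
    and "1 \<le> b" and "1 \<le> m"
  shows "let R = (\<lambda>\<omega>. minibatch_regret b \<phi> (\<alpha> (\<sigma>\<^sup>2 / real b)) (w1, a1) f g wstar (\<lambda>i. Z i \<omega>) m)
         in integrable M R \<and>
            (\<integral>\<omega>. R \<omega> \<partial>M) \<le> real b * \<psi> (\<sigma>\<^sup>2 / real b) (nat \<lceil>real m / real b\<rceil>) \<and>
            (\<forall>D\<ge>0. (\<forall>v\<ge>0. \<forall>k\<ge>1. \<psi> v k = 2 * D\<^sup>2 * L + 2 * D * sqrt v * sqrt (real k)) \<longrightarrow>
               (\<integral>\<omega>. R \<omega> \<partial>M) \<le> 2 * real b * D\<^sup>2 * L + 2 * D * \<sigma> * sqrt (real (m + b)))"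
proof -
  note P = \<open>prob_space P\<close> and M = \<open>prob_space M\<close> and Z = \<open>iid_samples M P Z\<close> and b = \<open>1 \<le> b\<close>
    and loss = \<open>convex_smooth_loss W L (space P) f g\<close>
    and EF = \<open>has_expected_loss W P f g F gradF\<close>
    and upd = \<open>update_rule W A \<phi>\<close> \<open>w1 \<in> W\<close> \<open>a1 \<in> space A\<close>
  interpret P: prob_space P by (rule P)
  interpret M: prob_space M by (rule M)
  have wstar: "wstar \<in> W" "\<And>w. w \<in> W \<Longrightarrow> F wstar \<le> F w"
    using \<open>is_arg_min F _ wstar\<close> by (auto simp: is_arg_min_def not_less)
  define v where "v = \<sigma>\<^sup>2 / real b"
  define P' where "P' = PiM {1..b} (\<lambda>_. P)"
  define f' where "f' = batch_mean b f"
  define g' where "g' = batch_mean b g"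
  define Y where "Y j \<omega> = block b (\<lambda>i. Z i \<omega>) j" for j \<omega>
  define X where "X j \<omega> = prediction \<phi> (\<alpha> v) (w1, a1) (serial_gradient g' (\<lambda>j. Y j \<omega>)) j" for j \<omega>
  define h where "h w z = f w z - f wstar z" for w z
  \<comment> \<open>\<open>\<nu> j\<close> is the expected excess risk of the prediction on block
    \<open>j\<close>, an integral over the law of that prediction alone.\<close>
  define \<nu> where "\<nu> j = (\<integral>w. F w - F wstar \<partial>distr M (restrict_space borel W) (X j))" for j
  have v: "0 \<le> v"
    by (simp add: v_def)
  have P': "prob_space P'"
    unfolding P'_def by (rule prob_space_PiM) (rule P)
  have space_P': "space P' = PiE {1..b} (\<lambda>_. space P)"
    by (simp add: P'_def space_PiM)
  have loss': "convex_smooth_loss W L (space P') f' g'"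
    unfolding space_P' f'_def g'_def by (rule convex_smooth_loss_batch_mean) fact+
  have EF': "has_expected_loss W P' f' g' F gradF"
    unfolding P'_def f'_def g'_def by (rule has_expected_loss_batch_mean) fact+
  have var': "bounded_variance W P' g' gradF v"
    unfolding P'_def g'_def v_def by (rule bounded_variance_batch_mean) fact+
  have Y: "iid_samples M P' Y"
    unfolding P'_def Y_def[abs_def] by (rule iid_samples_block) fact+
  note g'_meas = borel_measurable_loss_gradient(2)[OF loss' EF']

  have mb: "minibatch_gradient b g (\<lambda>i. Z i \<omega>) = serial_gradient g' (\<lambda>j. Y j \<omega>)" for \<omega>
    by (simp add: minibatch_gradient_eq_serial_gradient g'_def Y_def)
  have f'h: "f' (X j \<omega>) (Y j \<omega>) - f' wstar (Y j \<omega>) = (1 / real b) * (\<Sum>s=1..b. h (X j \<omega>) (Y j \<omega> s))" for j \<omega>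
    by (simp add: f'_def batch_mean_def h_def sum_subtractf right_diff_distrib diff_divide_distrib)
  \<comment> \<open>The serial regret of the averaged loss over \<open>k\<close> blocks, spelled out
    in single samples.\<close>
  define S where "S k \<omega> = (\<Sum>j=1..k. (1 / real b) * (\<Sum>s=1..b. h (X j \<omega>) (Y j \<omega> s)))" for k \<omega>
  have S: "S k \<omega> = serial_regret \<phi> (\<alpha> v) (w1, a1) f' g' wstar (\<lambda>j. Y j \<omega>) k" for k \<omega>
    unfolding serial_regret_def S_def X_def[symmetric] f'h ..
  \<comment> \<open>The serial bound is assumed for samples of type
    \<open>nat \<Rightarrow> 'z\<close>, the type of blocks, so it applies to
    \<open>P'\<close>.\<close>
  have S_int: "integrable M (S k)" and S_le: "(\<integral>\<omega>. S k \<omega> \<partial>M) \<le> \<psi> v k" if "1 \<le> k" for k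
    using serial_regret_bound_iid_samples[OF \<open>serial_regret_bound _ _ _ _ _ _ _ _ _ _\<close> v P' loss' EF' var' M Y that]
    by (simp_all add: S[abs_def])

  have sample: "has_bochner_integral M (\<lambda>\<omega>. h (X j \<omega>) (Y j \<omega> s)) (\<nu> j)"
    and nonneg: "0 \<le> \<nu> j" if j: "1 \<le> j" and s: "s \<in> {1..b}" for j s
  proof -
    let ?B = "restrict_space borel W"
    define Q where "Q = distr M ?B (X j)"
    have X: "X j \<in> M \<rightarrow>\<^sub>M ?B" and XY: "distr M (?B \<Otimes>\<^sub>M P') (\<lambda>\<omega>. (X j \<omega>, Y j \<omega>)) = Q \<Otimes>\<^sub>M P'"
      using distr_prediction_sample[OF M Y j upd g'_meas] by (simp_all add: X_def[abs_def] Q_def)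
    have Q: "prob_space Q"
      unfolding Q_def by (rule M.prob_space_distr[OF X])
    have sets_Q: "sets Q = sets ?B" and space_Q: "space Q = W"
      by (simp_all add: Q_def space_restrict_space)
    have Yj: "Y j \<in> M \<rightarrow>\<^sub>M P'"
      by (rule iid_samples_measurable[OF M Y j])
    have XYm: "(\<lambda>\<omega>. (X j \<omega>, Y j \<omega>)) \<in> M \<rightarrow>\<^sub>M ?B \<Otimes>\<^sub>M P'"
      by (rule measurable_Pair[OF X Yj])
    have "(\<lambda>p. f wstar (snd p)) \<in> borel_measurable (?B \<Otimes>\<^sub>M P)"
      using EF wstar by (intro measurable_compose[OF measurable_snd])
        (auto simp: has_expected_loss_def has_bochner_integral_iff)
    then have "(\<lambda>(w, z). h w z) \<in> borel_measurable (?B \<Otimes>\<^sub>M P)"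
      using borel_measurable_loss_gradient(1)[OF loss EF] by (simp add: h_def case_prod_beta)
    then have hm: "(\<lambda>(w, z). h w z) \<in> borel_measurable (Q \<Otimes>\<^sub>M P)"
      using measurable_cong_sets[OF sets_pair_measure_cong[OF sets_Q refl] refl] by blast
    have mean: "has_bochner_integral P (h w) (F w - F wstar)" if "w \<in> space Q" for w
      using EF wstar that unfolding h_def[abs_def] space_Q has_expected_loss_def
      by (intro has_bochner_integral_diff) auto
    have hs: "(\<lambda>(w, \<zeta>). h w (\<zeta> t)) \<in> borel_measurable (?B \<Otimes>\<^sub>M P')" if "t \<in> {1..b}" for t
    proof -
      have "(\<lambda>p. (fst p, snd p t)) \<in> ?B \<Otimes>\<^sub>M P' \<rightarrow>\<^sub>M ?B \<Otimes>\<^sub>M P"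
        unfolding P'_def using that by measurable
      from measurable_compose[OF this \<open>(\<lambda>(w, z). h w z) \<in> borel_measurable (?B \<Otimes>\<^sub>M P)\<close>] show ?thesis
        by (simp add: case_prod_beta)
    qed
    \<comment> \<open>The regret of block \<open>j\<close> alone is a difference of consecutive
      sums. The serial bound starts at one step; the empty sum for \<open>j = 1\<close> is treated
      directly.\<close>
    have "integrable M (S (j - 1))"
      using S_int[of "j - 1"] by (cases "j - 1") (simp_all add: S_def[abs_def])
    with S_int[OF j] have "integrable M (\<lambda>\<omega>. S j \<omega> - S (j - 1) \<omega>)"
      by (rule Bochner_Integration.integrable_diff)
    moreover have "S j \<omega> - S (j - 1) \<omega> = (1 / real b) * (\<Sum>t=1..b. h (X j \<omega>) (Y j \<omega> t))" for \<omega>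
      using j by (cases j) (auto simp: S_def)
    ultimately have "integrable M (\<lambda>\<omega>. real b * ((1 / real b) * (\<Sum>t=1..b. h (X j \<omega>) (Y j \<omega> t))))"
      by (intro integrable_mult_right[where c="real b"]) (simp only:)
    then have "integrable M (\<lambda>\<omega>. \<Sum>t=1..b. h (X j \<omega>) (Y j \<omega> t))"
      using b by simp
    \<comment> \<open>Pass to the joint law of prediction and block, which is a product measure;
      there the terms of the block are i.i.d. given the prediction.\<close>
    then have "integrable (Q \<Otimes>\<^sub>M P') (\<lambda>(w, \<zeta>). \<Sum>t=1..b. h w (\<zeta> t))"
      unfolding XY[symmetric] using hs
      by (subst integrable_distr_eq[OF XYm]) (auto simp: case_prod_beta intro!: borel_measurable_sum)
    then have "has_bochner_integral (Q \<Otimes>\<^sub>M P') (\<lambda>(w, \<zeta>). h w (\<zeta> s)) (\<integral>w. F w - F wstar \<partial>Q)"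
      unfolding P'_def using s mean by (intro has_bochner_integral_single_of_sum[OF Q P _ _ hm]) auto
    then have "has_bochner_integral (Q \<Otimes>\<^sub>M P') (\<lambda>(w, \<zeta>). h w (\<zeta> s)) (\<nu> j)"
      by (simp add: \<nu>_def Q_def)
    then show "has_bochner_integral M (\<lambda>\<omega>. h (X j \<omega>) (Y j \<omega> s)) (\<nu> j)"
      unfolding XY[symmetric]
      using integrable_distr_eq[OF XYm hs[OF s]] integral_distr[OF XYm hs[OF s]]
      by (simp add: has_bochner_integral_iff)
    show "0 \<le> \<nu> j"
      unfolding \<nu>_def Q_def[symmetric] using wstar by (intro Bochner_Integration.integral_nonneg) (auto simp: space_Q)
  qed
  have nonneg_Suc: "0 \<le> \<nu> (Suc j)" for j
    using b nonneg[of "Suc j" 1] by simp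

  define R where "R \<omega> = minibatch_regret b \<phi> (\<alpha> v) (w1, a1) f g wstar (\<lambda>i. Z i \<omega>) m" for \<omega>
  \<comment> \<open>With \<open>i\<close> counted from 0, sample \<open>Suc i\<close> sits in block
    \<open>Suc (i div b)\<close> at position \<open>Suc (i mod b)\<close>.\<close>
  have R: "R \<omega> = (\<Sum>i<m. h (X (Suc (i div b)) \<omega>) (Y (Suc (i div b)) \<omega> (Suc (i mod b))))" for \<omega>
  proof -
    have Yi: "Y (Suc (i div b)) \<omega> (Suc (i mod b)) = Z (Suc i) \<omega>" for i
      using b by (auto simp: Y_def block_def Suc_le_eq mult.commute)
    have "R \<omega> = (\<Sum>i=1..m. h (X (nat \<lceil>real i / real b\<rceil>) \<omega>) (Z i \<omega>))"
      by (simp add: R_def minibatch_regret_def mb X_def h_def)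
    also have "\<dots> = (\<Sum>i<m. h (X (Suc (i div b)) \<omega>) (Z (Suc i) \<omega>))"
      using b by (simp add: sum.atLeast1_atMost_eq nat_ceiling_divide_Suc del: of_nat_Suc)
    finally show ?thesis
      by (simp add: Yi)
  qed
  have "has_bochner_integral M (\<lambda>\<omega>. \<Sum>i<m. h (X (Suc (i div b)) \<omega>) (Y (Suc (i div b)) \<omega> (Suc (i mod b))))
      (\<Sum>i<m. \<nu> (Suc (i div b)))"
    using b by (intro has_bochner_integral_sum sample) (auto simp: Suc_le_eq)
  then have R_int: "has_bochner_integral M R (\<Sum>i<m. \<nu> (Suc (i div b)))"
    by (simp add: R[abs_def])

  \<comment> \<open>The number of blocks, including a possibly incomplete last one.\<close>
  define k where "k = nat \<lceil>real m / real b\<rceil>"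
  have k: "k = Suc ((m - 1) div b)"
    using nat_ceiling_divide_Suc[OF b, of "m - 1"] \<open>1 \<le> m\<close> by (simp add: k_def)
  have "real m / real b \<le> real k"
    unfolding k_def by linarith
  then have "real m \<le> real (k * b)"
    using b by (simp add: field_simps)
  then have m_le: "m \<le> k * b"
    by (simp only: of_nat_le_iff)
  have "has_bochner_integral M (S k) (\<Sum>j=1..k. (1 / real b) * (\<Sum>s=1..b. \<nu> j))"
    unfolding S_def[abs_def]
    by (intro has_bochner_integral_sum has_bochner_integral_mult_right sample) auto
  then have S_eq: "(\<integral>\<omega>. S k \<omega> \<partial>M) = (\<Sum>j<k. \<nu> (Suc j))"
    using b by (simp add: has_bochner_integral_iff sum.atLeast1_atMost_eq)
  have "(\<integral>\<omega>. R \<omega> \<partial>M) = (\<Sum>i<m. \<nu> (Suc (i div b)))"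
    by (rule has_bochner_integral_integral_eq[OF R_int])
  \<comment> \<open>Completing the last block adds only terms \<open>\<nu> k\<close>, which are
    nonnegative because \<open>wstar\<close> minimises \<open>F\<close>.\<close>
  also have "\<dots> \<le> (\<Sum>i<k * b. \<nu> (Suc (i div b)))"
    using m_le nonneg_Suc by (intro sum_mono2) auto
  also have "\<dots> = (\<Sum>j<k. \<Sum>i=j * b..<j * b + b. \<nu> (Suc (i div b)))"
    by (rule sum.nat_group[symmetric])
  also have "\<dots> = (\<Sum>j<k. \<Sum>i=j * b..<j * b + b. \<nu> (Suc j))"
  proof (intro sum.cong refl)
    fix j i assume "i \<in> {j * b..<j * b + b}"
    then have "i div b = j"
      by (intro div_nat_eqI) (auto simp: algebra_simps)
    then show "\<nu> (Suc (i div b)) = \<nu> (Suc j)" by simp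
  qed
  \<comment> \<open>In \<open>S k\<close> the \<open>b\<close> equal means of a block are averaged
    to one \<open>\<nu> j\<close>; here they are summed, hence the factor \<open>b\<close>.\<close>
  also have "\<dots> = real b * (\<integral>\<omega>. S k \<omega> \<partial>M)"
    by (simp add: S_eq sum_distrib_left)
  also have "\<dots> \<le> real b * \<psi> v k"
    using S_le[of k] k by (intro mult_left_mono) auto
  finally have R_le: "(\<integral>\<omega>. R \<omega> \<partial>M) \<le> real b * \<psi> v k" .

  have "(\<integral>\<omega>. R \<omega> \<partial>M) \<le> 2 * real b * D\<^sup>2 * L + 2 * D * \<sigma> * sqrt (real (m + b))"
    if "0 \<le> D" and \<psi>: "\<forall>v\<ge>0. \<forall>k\<ge>1. \<psi> v k = 2 * D\<^sup>2 * L + 2 * D * sqrt v * sqrt (real k)" for D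
  proof -
    \<comment> \<open>Rounding \<open>m\<close> up to full blocks adds at most \<open>b\<close>
      samples, which is the source of \<open>m + b\<close> under the root.\<close>
    have "(m - 1) div b * b \<le> m"
      by (rule order_trans[OF div_times_less_eq_dividend diff_le_self])
    then have "k * b \<le> m + b"
      by (simp add: k)
    then have kb: "real b * real k \<le> real (m + b)"
      by (metis mult.commute of_nat_le_iff of_nat_mult)
    \<comment> \<open>With \<open>v = \<sigma>\<^sup>2 / b\<close>, the factor \<open>b\<close> in
      front becomes \<open>sqrt b\<close> and joins \<open>sqrt k\<close> under one root.\<close>
    have "real b * sqrt v = \<sigma> * (real b / sqrt (real b))"
      using \<open>0 \<le> \<sigma>\<close> by (simp add: v_def real_sqrt_divide)
    also have "real b / sqrt (real b) = sqrt (real b)"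
      by (rule real_div_sqrt) simp
    finally have "real b * sqrt v = \<sigma> * sqrt (real b)" .
    then have "real b * (sqrt v * sqrt (real k)) = \<sigma> * sqrt (real b * real k)"
      by (simp add: real_sqrt_mult flip: mult.assoc)
    also have "\<dots> \<le> \<sigma> * sqrt (real (m + b))"
      using \<open>0 \<le> \<sigma>\<close> kb by (intro mult_left_mono real_sqrt_le_mono) auto
    finally have "2 * D * (real b * (sqrt v * sqrt (real k))) \<le> 2 * D * (\<sigma> * sqrt (real (m + b)))"
      using \<open>0 \<le> D\<close> by (intro mult_left_mono) auto
    moreover have "\<psi> v k = 2 * D\<^sup>2 * L + 2 * D * sqrt v * sqrt (real k)"
      using \<psi> v k by simp
    ultimately show ?thesis
      using R_le by (simp add: algebra_simps)
  qed
  then show ?thesis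
    using R_int R_le unfolding R_def v_def k_def Let_def
    by (auto simp only: has_bochner_integral_iff R_def)
qed

end
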